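(* Let $R$ be a ring and $a\in R$. Then $a$ has at most one generalized Zhou inverse in $R$, and if a generalized Zhou inverse $a^{z}$ of $a$ exists, it is exactly the p-Drazin inverse of $a$, i.e., $a$ has a p-Drazin inverse $a^{\ddag}$ and $a^{z}=a^{\ddag}$.
   Context: All rings are associative with identity $1$ (not necessarily commutative). $\mathbb{N}$ denotes the positive integers. $J(R)$ is the Jacobson radical of $R$ and $\sqrt{J(R)}=\{x\in R : x^m\in J(R)\text{ for some } m\in\mathbb{N}\}$. For $a\in R$, $comm(a)=\{x\in R: xa=ax\}$ and $comm^2(a)=\{x\in R: xy=yx\text{ for all }y\in comm(a)\}$. A generalized Zhou inverse of $a\in R$ is an element $b\in R$ such that $b=bab$, $b\in comm^2(a)$ and $a^n-ab\in\sqrt{J(R)}$ for some $n\in\mathbb{N}$; it is denoted $a^{z}$. A p-Drazin inverse of $a\in R$ is an element $b\in R$ such that $b=bab$, $b\in comm^2(a)$ and $a-a^2b\in\sqrt{J(R)}$; it is known to be unique if it exists and is denoted $a^{\ddag}$. *)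

theory Defs
  imports "HOL-Algebra.Ideal"
begin

locale left_ideal = additive_subgroup I R + ring R for I and R (structure) +
  assumes left_closed: "\<lbrakk>x \<in> I; r \<in> carrier R\<rbrakk> \<Longrightarrow> r \<otimes> x \<in> I"

locale maximal_left_ideal = left_ideal +
  assumes proper: "I \<noteq> carrier R"
    and maximal: "\<lbrakk>left_ideal K R; I \<subseteq> K; K \<subseteq> carrier R\<rbrakk> \<Longrightarrow> K = I \<or> K = carrier R"

(* Intersecting with the carrier matters only for the zero ring, which has no
   maximal left ideals; its radical is then the whole ring. *)
definition jacobson_radical :: "('a, 'b) ring_scheme \<Rightarrow> 'a set" where
  "jacobson_radical R = carrier R \<inter> \<Inter>{M. maximal_left_ideal M R}"

definition sqrt_jacobson :: "('a, 'b) ring_scheme \<Rightarrow> 'a set" where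
  "sqrt_jacobson R =
     {x \<in> carrier R. \<exists>m::nat. m \<ge> 1 \<and> x [^]\<^bsub>R\<^esub> m \<in> jacobson_radical R}"

definition commutant :: "('a, 'b) ring_scheme \<Rightarrow> 'a \<Rightarrow> 'a set" where
  "commutant R a = {x \<in> carrier R. x \<otimes>\<^bsub>R\<^esub> a = a \<otimes>\<^bsub>R\<^esub> x}"

definition bicommutant :: "('a, 'b) ring_scheme \<Rightarrow> 'a \<Rightarrow> 'a set" where
  "bicommutant R a =
     {x \<in> carrier R. \<forall>y \<in> commutant R a. x \<otimes>\<^bsub>R\<^esub> y = y \<otimes>\<^bsub>R\<^esub> x}"

definition is_gen_zhou_inverse :: "('a, 'b) ring_scheme \<Rightarrow> 'a \<Rightarrow> 'a \<Rightarrow> bool" where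
  "is_gen_zhou_inverse R a b \<longleftrightarrow>
     b \<in> carrier R \<and>
     b = b \<otimes>\<^bsub>R\<^esub> a \<otimes>\<^bsub>R\<^esub> b \<and>
     b \<in> bicommutant R a \<and>
     (\<exists>n::nat. n \<ge> 1 \<and> a [^]\<^bsub>R\<^esub> n \<ominus>\<^bsub>R\<^esub> a \<otimes>\<^bsub>R\<^esub> b \<in> sqrt_jacobson R)"

definition is_pdrazin_inverse :: "('a, 'b) ring_scheme \<Rightarrow> 'a \<Rightarrow> 'a \<Rightarrow> bool" where
  "is_pdrazin_inverse R a b \<longleftrightarrow>
     b \<in> carrier R \<and>
     b = b \<otimes>\<^bsub>R\<^esub> a \<otimes>\<^bsub>R\<^esub> b \<and>
     b \<in> bicommutant R a \<and>
     a \<ominus>\<^bsub>R\<^esub> a [^]\<^bsub>R\<^esub> (2::nat) \<otimes>\<^bsub>R\<^esub> b \<in> sqrt_jacobson R"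

(* Meaningful only where the p-Drazin inverse exists uniquely. *)
definition pdrazin_inverse :: "('a, 'b) ring_scheme \<Rightarrow> 'a \<Rightarrow> 'a" where
  "pdrazin_inverse R a = (THE b. is_pdrazin_inverse R a b)"

end

theory Submission
  imports Defs
begin

text \<open>
  Let \<open>b\<close> be a generalized Zhou inverse of \<open>a\<close>, and let \<open>p = a b\<close>, an idempotent that commutes
  with \<open>a\<close>. The complementary idempotent \<open>f = 1 - p\<close> kills \<open>p\<close>, so that \<open>f (a^n - p) = f a^n\<close>.
  If \<open>(a^n - p)^m\<close> lies in the Jacobson radical, then so does
  \<open>f (a^n - p)^m = f a^(n m) = (a f)^(n m)\<close>, and \<open>a f = a - a^2 b\<close>. Hence every generalized Zhou
  inverse is a p-Drazin inverse (\<open>zhou_imp_pdrazin\<close>), and both claims reduce to the uniqueness of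
  p-Drazin inverses.

  For that, let \<open>b\<close> and \<open>c\<close> be p-Drazin inverses of \<open>a\<close>, with idempotents \<open>p = a b\<close> and
  \<open>q = a c\<close>. Membership in the double commutant makes \<open>a\<close>, \<open>b\<close>, \<open>c\<close> commute with each other, so
  \<open>e = p (1 - q) = b (a (1 - q))\<close> is idempotent and \<open>e = e^k = b^k (a (1 - q))^k\<close> lies in the
  radical for some \<open>k\<close>. The radical contains no idempotent but zero, because \<open>R (1 - e)\<close> would
  otherwise be a proper left ideal, contained in a maximal one, which would contain both \<open>e\<close> and
  \<open>1 - e\<close> (\<open>idempotent_in_jacobson_radical\<close>). Thus \<open>p = p q\<close>, by symmetry \<open>q = p q\<close>, and
  \<open>b = b p = b q = p c = q c = c\<close>.
\<close>

section \<open>Left ideals and the Jacobson radical\<close>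

context ring
begin

text \<open>Closure under negation comes from multiplication by \<open>\<ominus> \<one>\<close>.\<close>

lemma left_idealI:
  assumes "I \<subseteq> carrier R" "\<zero> \<in> I"
    and add: "\<And>x y. \<lbrakk>x \<in> I; y \<in> I\<rbrakk> \<Longrightarrow> x \<oplus> y \<in> I"
    and mult: "\<And>x r. \<lbrakk>x \<in> I; r \<in> carrier R\<rbrakk> \<Longrightarrow> r \<otimes> x \<in> I"
  shows "left_ideal I R"
proof -
  have "\<ominus> x \<in> I" if "x \<in> I" for x
  proof -
    have "\<ominus> x = (\<ominus> \<one>) \<otimes> x" using that assms(1) by (simp add: l_minus subset_iff)
    then show ?thesis using mult[OF that, of "\<ominus> \<one>"] by simp
  qed
  then have "subgroup I (add_monoid R)"
    using assms by (intro add.subgroupI) (auto simp: a_inv_def)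
  then have "additive_subgroup I R" by (rule additive_subgroup.intro)
  then show ?thesis
    using mult by (intro left_ideal.intro left_ideal_axioms.intro ring_axioms) auto
qed

lemma left_ideal_carrier: "left_ideal I R \<Longrightarrow> x \<in> I \<Longrightarrow> x \<in> carrier R"
  by (meson additive_subgroup.a_Hcarr left_ideal.axioms(1))

lemma left_ideal_zero: "left_ideal I R \<Longrightarrow> \<zero> \<in> I"
  by (meson additive_subgroup.zero_closed left_ideal.axioms(1))

lemma left_ideal_add: "left_ideal I R \<Longrightarrow> x \<in> I \<Longrightarrow> y \<in> I \<Longrightarrow> x \<oplus> y \<in> I"
  by (meson additive_subgroup.a_closed left_ideal.axioms(1))

lemma left_ideal_one: "left_ideal I R \<Longrightarrow> \<one> \<in> I \<Longrightarrow> I = carrier R"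
  using left_ideal.left_closed[of I R \<one>] left_ideal_carrier[of I] by fastforce

lemma principal_left_ideal:
  assumes "x \<in> carrier R"
  shows "left_ideal {r \<otimes> x | r. r \<in> carrier R} R"
proof (rule left_idealI)
  show "\<zero> \<in> {r \<otimes> x | r. r \<in> carrier R}"
    using assms l_null[of x] by (force intro: exI[of _ \<zero>])
next
  fix u v assume "u \<in> {r \<otimes> x | r. r \<in> carrier R}" "v \<in> {r \<otimes> x | r. r \<in> carrier R}"
  then obtain r s where "r \<in> carrier R" "s \<in> carrier R" "u = r \<otimes> x" "v = s \<otimes> x" by auto
  then have "u \<oplus> v = (r \<oplus> s) \<otimes> x" "r \<oplus> s \<in> carrier R" using assms by (auto simp: l_distr)
  then show "u \<oplus> v \<in> {r \<otimes> x | r. r \<in> carrier R}" by blast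
next
  fix u t assume "u \<in> {r \<otimes> x | r. r \<in> carrier R}" "t \<in> carrier R"
  then obtain r where "r \<in> carrier R" "u = r \<otimes> x" by auto
  then have "t \<otimes> u = (t \<otimes> r) \<otimes> x" "t \<otimes> r \<in> carrier R"
    using assms \<open>t \<in> carrier R\<close> by (auto simp: m_assoc)
  then show "t \<otimes> u \<in> {r \<otimes> x | r. r \<in> carrier R}" by blast
qed (use assms in auto)

lemma left_ideal_Union_chain:
  assumes "C \<noteq> {}" "\<And>I. I \<in> C \<Longrightarrow> left_ideal I R"
    and chain: "\<And>I K. I \<in> C \<Longrightarrow> K \<in> C \<Longrightarrow> I \<subseteq> K \<or> K \<subseteq> I"
  shows "left_ideal (\<Union>C) R"
proof (rule left_idealI)
  show "\<Union>C \<subseteq> carrier R" using assms(2) left_ideal_carrier by blast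
  show "\<zero> \<in> \<Union>C" using assms(1,2) left_ideal_zero by blast
next
  fix x y assume "x \<in> \<Union>C" "y \<in> \<Union>C"
  then obtain I K where IK: "I \<in> C" "K \<in> C" "x \<in> I" "y \<in> K" by blast
  with chain[of I K] obtain L where "L \<in> C" "x \<in> L" "y \<in> L" by blast
  then show "x \<oplus> y \<in> \<Union>C" using left_ideal_add assms(2) by blast
next
  fix x r assume "x \<in> \<Union>C" and r: "r \<in> carrier R"
  then obtain I where I: "I \<in> C" "x \<in> I" by blast
  then show "r \<otimes> x \<in> \<Union>C" using left_ideal.left_closed[OF assms(2)[OF I(1)] I(2) r] by blast
qed

text \<open>Properness of a left ideal means that it omits \<open>\<one>\<close>, and this survives unions of chains, so
  Zorn's lemma applies.\<close>

lemma exists_maximal_left_ideal: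
  assumes "left_ideal L R" "\<one> \<notin> L"
  shows "\<exists>M. maximal_left_ideal M R \<and> L \<subseteq> M"
proof -
  let ?A = "{I. left_ideal I R \<and> L \<subseteq> I \<and> \<one> \<notin> I}"
  have "\<exists>M\<in>?A. \<forall>X\<in>?A. M \<subseteq> X \<longrightarrow> X = M"
  proof (rule subset_Zorn_nonempty)
    show "?A \<noteq> {}" using assms by blast
  next
    fix C assume C: "C \<noteq> {}" "subset.chain ?A C"
    then have mem: "\<And>I. I \<in> C \<Longrightarrow> left_ideal I R \<and> L \<subseteq> I \<and> \<one> \<notin> I"
      by (auto simp: subset_chain_def)
    have "left_ideal (\<Union>C) R"
      using C mem by (intro left_ideal_Union_chain) (auto simp: subset_chain_def)
    then show "\<Union>C \<in> ?A" using C(1) mem by blast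
  qed
  then obtain M where M: "left_ideal M R" "L \<subseteq> M" "\<one> \<notin> M"
    and max: "\<And>X. left_ideal X R \<Longrightarrow> L \<subseteq> X \<Longrightarrow> \<one> \<notin> X \<Longrightarrow> M \<subseteq> X \<Longrightarrow> X = M"
    by auto
  have "maximal_left_ideal M R"
  proof (intro maximal_left_ideal.intro maximal_left_ideal_axioms.intro)
    show "left_ideal M R" "M \<noteq> carrier R" using M by auto
  next
    fix K assume "left_ideal K R" "M \<subseteq> K"
    then show "K = M \<or> K = carrier R"
      using max[of K] M(2) left_ideal_one[of K] by (cases "\<one> \<in> K") auto
  qed
  then show ?thesis using M(2) by blast
qed

lemma jacobson_radical_left_closed:
  assumes "x \<in> jacobson_radical R" "r \<in> carrier R"
  shows "r \<otimes> x \<in> jacobson_radical R"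
proof -
  have "r \<otimes> x \<in> M" if M: "maximal_left_ideal M R" for M
    using assms M left_ideal.left_closed[OF maximal_left_ideal.axioms(1)[OF M]]
    by (simp add: jacobson_radical_def)
  then show ?thesis using assms by (simp add: jacobson_radical_def)
qed

text \<open>If \<open>\<one> = r \<otimes> (\<one> \<ominus> e)\<close>, then multiplying by \<open>e\<close> on the right gives \<open>e = \<zero>\<close>. Otherwise
  \<open>\<one> \<ominus> e\<close> lies in a maximal left ideal, which contains \<open>e\<close> by assumption and thus also \<open>\<one>\<close>, a
  contradiction.\<close>

lemma idempotent_in_jacobson_radical:
  assumes e: "e \<in> jacobson_radical R" and idem: "e \<otimes> e = e"
  shows "e = \<zero>"
proof (rule ccontr)
  assume "e \<noteq> \<zero>"
  have eR: "e \<in> carrier R" using e by (simp add: jacobson_radical_def)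
  let ?f = "\<one> \<ominus> e"
  let ?L = "{r \<otimes> ?f | r. r \<in> carrier R}"
  have fR: "?f \<in> carrier R" using eR by simp
  have fe: "?f \<otimes> e = \<zero>" using eR idem by (simp add: minus_eq l_distr l_minus r_neg)
  have "\<one> \<notin> ?L"
  proof
    assume "\<one> \<in> ?L"
    then obtain r where r: "r \<in> carrier R" "\<one> = r \<otimes> ?f" by auto
    then have "e = (r \<otimes> ?f) \<otimes> e" using eR l_one by metis
    also have "\<dots> = \<zero>" using r(1) eR fR fe by (simp add: m_assoc)
    finally show False using \<open>e \<noteq> \<zero>\<close> by simp
  qed
  then obtain M where M: "maximal_left_ideal M R" "?L \<subseteq> M"
    using exists_maximal_left_ideal[OF principal_left_ideal[OF fR]] by blast
  have MI: "left_ideal M R" using M(1) by (rule maximal_left_ideal.axioms(1))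
  have "?f \<in> ?L" using fR l_one[of ?f] by (metis (mono_tags, lifting) mem_Collect_eq one_closed)
  then have "?f \<in> M" using M(2) by blast
  moreover have "e \<in> M" using e M(1) by (auto simp: jacobson_radical_def)
  ultimately have "?f \<oplus> e \<in> M" using left_ideal_add[OF MI] by blast
  moreover have "?f \<oplus> e = \<one>" using eR by (simp add: minus_eq a_assoc l_neg)
  ultimately have "M = carrier R" using left_ideal_one[OF MI] by simp
  then show False using maximal_left_ideal.proper[OF M(1)] by simp
qed

section \<open>Commuting idempotents\<close>

lemma idempotent_pow:
  assumes "f \<in> carrier R" "f \<otimes> f = f" "k \<ge> (1::nat)"
  shows "f [^] k = f"
  using assms(3) by (induction k rule: dec_induct) (use assms(1,2) in auto)

lemma idempotent_mult_pow:
  assumes "f \<in> carrier R" "f \<otimes> f = f" "x \<in> carrier R" "f \<otimes> x = x \<otimes> f" "k \<ge> (1::nat)"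
  shows "(f \<otimes> x) [^] k = f \<otimes> x [^] k"
  using pow_mult_distrib[of f x k] idempotent_pow[of f k] assms by simp

lemma idempotent_complement:
  assumes "p \<in> carrier R" "p \<otimes> p = p"
  shows "(\<one> \<ominus> p) \<otimes> (\<one> \<ominus> p) = \<one> \<ominus> p" "(\<one> \<ominus> p) \<otimes> p = \<zero>"
proof -
  show z: "(\<one> \<ominus> p) \<otimes> p = \<zero>" using assms by (simp add: minus_eq l_distr l_minus r_neg)
  have "(\<one> \<ominus> p) \<otimes> (\<one> \<ominus> p) = (\<one> \<ominus> p) \<ominus> (\<one> \<ominus> p) \<otimes> p"
    using assms(1) by (simp add: minus_eq r_distr r_minus)
  then show "(\<one> \<ominus> p) \<otimes> (\<one> \<ominus> p) = \<one> \<ominus> p" using z assms(1) by (simp add: minus_eq)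
qed

lemma commutes_complement:
  assumes "p \<in> carrier R" "x \<in> carrier R" "p \<otimes> x = x \<otimes> p"
  shows "(\<one> \<ominus> p) \<otimes> x = x \<otimes> (\<one> \<ominus> p)"
  using assms by (simp add: minus_eq l_distr r_distr l_minus r_minus)

lemma left_commute:
  "\<lbrakk>x \<in> carrier R; y \<in> carrier R; z \<in> carrier R; x \<otimes> y = y \<otimes> x\<rbrakk> \<Longrightarrow> x \<otimes> (y \<otimes> z) = y \<otimes> (x \<otimes> z)"
  by (simp flip: m_assoc)

section \<open>Generalized Zhou inverses and p-Drazin inverses\<close>

lemma bicommutant_commutes:
  "\<lbrakk>b \<in> bicommutant R a; y \<in> carrier R; y \<otimes> a = a \<otimes> y\<rbrakk> \<Longrightarrow> b \<otimes> y = y \<otimes> b"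
  by (auto simp: bicommutant_def commutant_def)

text \<open>These facts rest only on the two conditions that generalized Zhou inverses and p-Drazin
  inverses share. The last equation makes the p-Drazin condition one on powers of
  \<open>(\<one> \<ominus> a \<otimes> b) \<otimes> a\<close>, a product of commuting factors of which one is idempotent.\<close>

lemma outer_inverse_idempotent:
  assumes a: "a \<in> carrier R" and b: "b \<in> carrier R" "b = b \<otimes> a \<otimes> b" "b \<in> bicommutant R a"
  shows "b \<otimes> a = a \<otimes> b" "(a \<otimes> b) \<otimes> (a \<otimes> b) = a \<otimes> b" "(a \<otimes> b) \<otimes> a = a \<otimes> (a \<otimes> b)"
    "a \<ominus> a [^] (2::nat) \<otimes> b = (\<one> \<ominus> a \<otimes> b) \<otimes> a"
proof -
  show comm: "b \<otimes> a = a \<otimes> b" using bicommutant_commutes[OF b(3) a] by simp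
  have "(a \<otimes> b) \<otimes> (a \<otimes> b) = a \<otimes> (b \<otimes> a \<otimes> b)" using a b(1) by (simp add: m_assoc)
  then show "(a \<otimes> b) \<otimes> (a \<otimes> b) = a \<otimes> b" by (simp only: b(2)[symmetric])
  show aba: "(a \<otimes> b) \<otimes> a = a \<otimes> (a \<otimes> b)" using a b(1) comm by (simp add: m_assoc)
  have "a [^] (2::nat) \<otimes> b = (a \<otimes> b) \<otimes> a"
    using a b(1) aba by (simp add: numeral_2_eq_2 m_assoc)
  then show "a \<ominus> a [^] (2::nat) \<otimes> b = (\<one> \<ominus> a \<otimes> b) \<otimes> a"
    using a b(1) by (simp add: minus_eq l_distr l_minus)
qed

text \<open>With \<open>f = \<one> \<ominus> a \<otimes> b\<close>, multiplication by \<open>f\<close> turns \<open>a\<^sup>n \<ominus> a \<otimes> b\<close> into \<open>f \<otimes> a\<^sup>n\<close>, whose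
  powers are powers of \<open>f \<otimes> a\<close>.\<close>

lemma zhou_imp_pdrazin:
  assumes a: "a \<in> carrier R" and z: "is_gen_zhou_inverse R a b"
  shows "is_pdrazin_inverse R a b"
proof -
  have b: "b \<in> carrier R" "b = b \<otimes> a \<otimes> b" "b \<in> bicommutant R a"
    using z by (auto simp: is_gen_zhou_inverse_def)
  define p where "p = a \<otimes> b"
  define f where "f = \<one> \<ominus> p"
  obtain n m :: nat where n: "n \<ge> 1" and m: "m \<ge> 1"
    and J: "(a [^] n \<ominus> p) [^] m \<in> jacobson_radical R"
    using z by (auto simp: is_gen_zhou_inverse_def sqrt_jacobson_def p_def)
  define x where "x = a [^] n \<ominus> p"
  note facts = outer_inverse_idempotent[OF a b, folded p_def]
  have pR: "p \<in> carrier R" using a b by (simp add: p_def)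
  have fR: "f \<in> carrier R" and xR: "x \<in> carrier R" using pR a by (auto simp: f_def x_def)
  have ff: "f \<otimes> f = f" and fp: "f \<otimes> p = \<zero>"
    using idempotent_complement[OF pR facts(2)] by (auto simp: f_def)
  have fa: "f \<otimes> a = a \<otimes> f" using commutes_complement[OF pR a facts(3)] by (simp add: f_def)
  have fan: "f \<otimes> a [^] n = a [^] n \<otimes> f"
    using group_commutes_pow[OF fa[symmetric] a fR] by simp
  have pfp: "p \<otimes> f = f \<otimes> p"
    using commutes_complement[OF pR pR refl] by (simp add: f_def)
  have fx: "f \<otimes> x = f \<otimes> a [^] n"
    using fR a pR fp by (simp add: x_def minus_eq r_distr r_minus)
  have xf: "f \<otimes> x = x \<otimes> f"
    using fR a pR fan pfp by (simp add: x_def minus_eq r_distr r_minus l_distr l_minus)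
  have "(f \<otimes> a) [^] (n * m) = f \<otimes> x [^] m"
  proof -
    have "(f \<otimes> a) [^] (n * m) = ((f \<otimes> a) [^] n) [^] m" using fR a by (simp add: nat_pow_pow)
    also have "\<dots> = (f \<otimes> x) [^] m" using idempotent_mult_pow[OF fR ff a fa n] fx by simp
    finally show ?thesis using idempotent_mult_pow[OF fR ff xR xf m] by simp
  qed
  also have "\<dots> \<in> jacobson_radical R"
    using J fR by (intro jacobson_radical_left_closed) (auto simp: x_def)
  finally have "(f \<otimes> a) [^] (n * m) \<in> jacobson_radical R" .
  moreover have "n * m \<ge> 1" using n m by simp
  ultimately have "f \<otimes> a \<in> sqrt_jacobson R"
    unfolding sqrt_jacobson_def using fR a by blast
  then show ?thesis using b facts(4) by (simp add: is_pdrazin_inverse_def f_def)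
qed

text \<open>The right-hand side minus the left-hand side is \<open>(\<one> \<ominus> a \<otimes> c) \<otimes> (a \<otimes> b) =
  b \<otimes> ((\<one> \<ominus> a \<otimes> c) \<otimes> a)\<close>, an idempotent. It equals all its positive powers, and
  some power of \<open>(\<one> \<ominus> a \<otimes> c) \<otimes> a\<close> lies in the radical, so it lies in the radical itself and
  vanishes.\<close>

lemma pdrazin_idempotent_absorb:
  assumes a: "a \<in> carrier R" and B: "is_pdrazin_inverse R a b" and C: "is_pdrazin_inverse R a c"
  shows "(a \<otimes> c) \<otimes> (a \<otimes> b) = a \<otimes> b"
proof -
  have b: "b \<in> carrier R" "b = b \<otimes> a \<otimes> b" "b \<in> bicommutant R a"
    and c: "c \<in> carrier R" "c = c \<otimes> a \<otimes> c" "c \<in> bicommutant R a"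
    and S: "a \<ominus> a [^] (2::nat) \<otimes> c \<in> sqrt_jacobson R"
    using B C by (auto simp: is_pdrazin_inverse_def)
  define p where "p = a \<otimes> b"
  define q where "q = a \<otimes> c"
  define f where "f = \<one> \<ominus> q"
  note fb = outer_inverse_idempotent[OF a b, folded p_def]
  note fc = outer_inverse_idempotent[OF a c, folded q_def]
  have R: "p \<in> carrier R" "q \<in> carrier R" "f \<in> carrier R" using a b c
    by (auto simp: p_def q_def f_def)
  have ff: "f \<otimes> f = f" using idempotent_complement[OF R(2) fc(2)] by (simp add: f_def)
  have fa: "f \<otimes> a = a \<otimes> f" using commutes_complement[OF R(2) a fc(3)] by (simp add: f_def)
  have bf: "b \<otimes> f = f \<otimes> b" using bicommutant_commutes[OF b(3) R(3) fa] .
  obtain k :: nat where k: "k \<ge> 1" and J: "(f \<otimes> a) [^] k \<in> jacobson_radical R"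
    using S fc(4) by (auto simp: sqrt_jacobson_def f_def)
  have e: "b \<otimes> (f \<otimes> a) = f \<otimes> p"
    using left_commute[OF b(1) R(3) a bf] fb(1) by (simp add: p_def)
  have comm: "b \<otimes> (f \<otimes> a) = (f \<otimes> a) \<otimes> b"
    unfolding e using a b(1) R(3) by (simp add: p_def m_assoc)
  have fp: "f \<otimes> p = p \<otimes> f"
    using left_commute[OF R(3) a b(1) fa] bf a b(1) R(3) by (simp add: p_def m_assoc)
  have "(f \<otimes> p) \<otimes> (f \<otimes> p) = (f \<otimes> f) \<otimes> (p \<otimes> p)"
    using left_commute[OF R(1,3,1) fp[symmetric]] R by (simp add: m_assoc)
  then have ee: "(f \<otimes> p) \<otimes> (f \<otimes> p) = f \<otimes> p" using ff fb(2) by simp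
  have "f \<otimes> p = (f \<otimes> p) [^] k" using idempotent_pow[OF _ ee k] R by simp
  also have "\<dots> = b [^] k \<otimes> (f \<otimes> a) [^] k"
    using pow_mult_distrib[OF comm] e a b(1) R by simp
  also have "\<dots> \<in> jacobson_radical R" using J b(1) by (intro jacobson_radical_left_closed) auto
  finally have "f \<otimes> p = \<zero>" using idempotent_in_jacobson_radical ee by blast
  then have "p \<ominus> q \<otimes> p = \<zero>" using R by (simp add: f_def minus_eq l_distr l_minus)
  moreover have "(p \<ominus> q \<otimes> p) \<oplus> q \<otimes> p = p" using R by (simp add: minus_eq a_assoc l_neg)
  ultimately show ?thesis using R unfolding p_def[symmetric] q_def[symmetric] by simp
qed

lemma pdrazin_inverse_unique:
  assumes a: "a \<in> carrier R" and B: "is_pdrazin_inverse R a b" and C: "is_pdrazin_inverse R a c"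
  shows "b = c"
proof -
  have b: "b \<in> carrier R" "b = b \<otimes> a \<otimes> b" "b \<in> bicommutant R a"
    and c: "c \<in> carrier R" "c = c \<otimes> a \<otimes> c" "c \<in> bicommutant R a"
    using B C by (auto simp: is_pdrazin_inverse_def)
  note fb = outer_inverse_idempotent[OF a b] and fc = outer_inverse_idempotent[OF a c]
  have abR: "a \<otimes> b \<in> carrier R" using a b(1) by simp
  have "(a \<otimes> b) \<otimes> a = a \<otimes> (a \<otimes> b)" by (rule fb(3))
  then have cp: "c \<otimes> (a \<otimes> b) = (a \<otimes> b) \<otimes> c" by (rule bicommutant_commutes[OF c(3) abR])
  have "(a \<otimes> c) \<otimes> (a \<otimes> b) = a \<otimes> ((a \<otimes> b) \<otimes> c)"
    unfolding cp[symmetric] by (rule m_assoc[OF a c(1) abR])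
  also have "\<dots> = (a \<otimes> b) \<otimes> (a \<otimes> c)"
    by (rule left_commute[OF a abR c(1) fb(3)[symmetric]])
  finally have "(a \<otimes> c) \<otimes> (a \<otimes> b) = (a \<otimes> b) \<otimes> (a \<otimes> c)" .
  then have eq: "a \<otimes> b = a \<otimes> c"
    using pdrazin_idempotent_absorb[OF a B C] pdrazin_idempotent_absorb[OF a C B] by simp
  have "b = b \<otimes> (a \<otimes> b)" using b(2) m_assoc[OF b(1) a b(1)] by (rule trans)
  also have "\<dots> = (a \<otimes> b) \<otimes> c"
    unfolding eq using m_assoc[OF b(1) a c(1)] fb(1) eq by simp
  also have "\<dots> = c \<otimes> a \<otimes> c" by (simp only: eq fc(1))
  also have "\<dots> = c" by (rule c(2)[symmetric])
  finally show ?thesis .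
qed

end

theorem corollary2p3:
  fixes R :: "('a, 'b) ring_scheme" and a :: 'a
  assumes "ring R" and "a \<in> carrier R"
  shows "(\<forall>b c. is_gen_zhou_inverse R a b \<and> is_gen_zhou_inverse R a c \<longrightarrow> b = c) \<and>
         (\<forall>z. is_gen_zhou_inverse R a z \<longrightarrow>
            (\<exists>!d. is_pdrazin_inverse R a d) \<and> z = pdrazin_inverse R a)"
proof -
  interpret ring R by fact
  note unique = pdrazin_inverse_unique[OF assms(2)]
  note zhou = zhou_imp_pdrazin[OF assms(2)]
  have "z = pdrazin_inverse R a" if "is_gen_zhou_inverse R a z" for z
    unfolding pdrazin_inverse_def using zhou[OF that] unique by (intro the_equality[symmetric]) auto
  then show ?thesis using zhou unique by blast
qed

end
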